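(* Let $K$ be a non-archimedean field, and let $\phi\in K(z)$ be a rational function of degree $d\geq 2$ with a totally invariant type II point $\xi\in\mathbb{P}^1_{\mathrm{Berk}}$. Let $U$ and $V$ be distinct components of $\mathbb{P}^1_{\mathrm{Berk}}\setminus\{\xi\}$ that both contain points of $\mathbb{P}^1(K)$, and such that $U$ is fixed while $\phi(V)\subseteq U$. Then there is a point $\alpha\in\mathbb{P}^1(\overline{K})\setminus(U\cup V)$ such that $[K(\alpha):K]\leq d$.
   Context: $K$ is a field, $\overline{K}$ an algebraic closure, $|\cdot|$ a non-archimedean absolute value on $\overline{K}$, $\mathbb{C}_v$ the completion of $\overline{K}$. $\mathbb{P}^1_{\mathrm{Berk}}$ is the Berkovich projective line over $\mathbb{C}_v$, a compact Hausdorff uniquely path-connected space containing $\mathbb{P}^1(\mathbb{C}_v)$, with a point $\zeta(a,r)$ for each closed disk $\bar D(a,r)\subseteq\mathbb{C}_v$, type II when $r\in|\mathbb{C}_v^\times|$; the components of $\mathbb{P}^1_{\mathrm{Berk}}\setminus\{\zeta(a,r)\}$ meet $\mathbb{P}^1(\mathbb{C}_v)$ in $\mathbb{P}^1(\mathbb{C}_v)\setminus\bar D(a,r)$ and in the open disks $D(b,r)$, $b\in\bar D(a,r)$. Rational functions extend uniquely to continuous self-maps of $\mathbb{P}^1_{\mathrm{Berk}}$. $\xi$ is totally invariant if $\phi^{-1}(\xi)=\{\xi\}$. A component $U$ is fixed if $\phi(U)\subseteq U$. *)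

theory Defs
  imports
    "HOL-Analysis.Analysis"
    "HOL-Algebra.Algebra"
    "HOL-Algebra.Algebraic_Closure_Type"
    "HOL-Library.Extended_Nat"
    "HOL-Computational_Algebra.Computational_Algebra"
begin

section \<open>The valued fields\<close>

locale nonarch_abs_value =
  fixes v :: "'c::field \<Rightarrow> real"
  assumes v_nonneg: "0 \<le> v x"
    and v_eq_0_iff: "v x = 0 \<longleftrightarrow> x = 0"
    and v_mult: "v (x * y) = v x * v y"
    and v_add: "v (x + y) \<le> max (v x) (v y)"

text \<open>
  The whole type plays the role of $\mathbb{C}_v$, and \<open>K\<close> and its algebraic closure \<open>Kbar\<close> are
  subfields of it. That $\mathbb{C}_v$ is the completion of \<open>Kbar\<close> is expressed by completeness
  of the metric and density of \<open>Kbar\<close>. The trivial absolute value is not excluded.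
\<close>

locale nonarch_setting = nonarch_abs_value v
  for v :: "'c::field \<Rightarrow> real" +
  fixes K Kbar :: "'c set"
  assumes K_subfield: "subfield K ring_of_type_algebra"
    and Kbar_subfield: "subfield Kbar ring_of_type_algebra"
    and Kbar_algebraic_closure:
      "algebraic_closure (ring_of_type_algebra\<lparr>carrier := Kbar\<rparr>) K"
    and complete: "Metric_space.mcomplete UNIV (\<lambda>x y. v (x - y))"
    and Kbar_dense: "Metric_space.mtopology UNIV (\<lambda>x y. v (x - y)) closure_of Kbar = UNIV"

text \<open>The point at infinity of a projective line is \<^term>\<open>None\<close>.\<close>

definition proj_line :: "'c set \<Rightarrow> 'c option set" where
  "proj_line F = insert None (Some ` F)"

text \<open>\<open>adjoin K \<alpha>\<close> is the field $K(\alpha)$, with $K(\infty) = K$.\<close>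

definition adjoin :: "'c::field set \<Rightarrow> 'c option \<Rightarrow> 'c set" where
  "adjoin K \<alpha> = (case \<alpha> of None \<Rightarrow> K
                 | Some a \<Rightarrow> generate_field ring_of_type_algebra (insert a K))"

definition ext_degree :: "'c::field set \<Rightarrow> 'c set \<Rightarrow> enat" where
  "ext_degree K L =
     (if ring.finite_dimension ring_of_type_algebra K L
      then enat (ring.dim ring_of_type_algebra K L) else \<infinity>)"


section \<open>The Berkovich projective line\<close>

definition berk_seminorm :: "('c::field \<Rightarrow> real) \<Rightarrow> ('c poly \<Rightarrow> real) \<Rightarrow> bool" where
  "berk_seminorm v s \<longleftrightarrow>
     (\<forall>f. 0 \<le> s f) \<and>
     (\<forall>f g. s (f + g) \<le> s f + s g) \<and>
     (\<forall>f g. s (f * g) = s f * s g) \<and>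
     (\<forall>c. s [:c:] = v c)"

text \<open>
  The Berkovich affine line carries the coarsest topology for which all maps $s \mapsto s(f)$
  are continuous; the projective line is its one-point compactification.
\<close>

definition berk_affine :: "('c::field \<Rightarrow> real) \<Rightarrow> ('c poly \<Rightarrow> real) topology" where
  "berk_affine v = subtopology (powertop_real UNIV) {s. berk_seminorm v s}"

type_synonym 'c berk_point = "('c poly \<Rightarrow> real) option"

definition berk_line :: "('c::field \<Rightarrow> real) \<Rightarrow> 'c berk_point topology" where
  "berk_line v = Alexandroff_compactification (berk_affine v)"

text \<open>The embedding of $\mathbb{P}^1(\mathbb{C}_v)$ as the set of type I points.\<close>

definition type_I :: "('c::field \<Rightarrow> real) \<Rightarrow> 'c option \<Rightarrow> 'c berk_point" where
  "type_I v = map_option (\<lambda>a f. v (poly f a))"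

text \<open>$\zeta(a,r)$ is the sup norm on the closed disk $\bar D(a,r)$.\<close>

definition zeta :: "('c::field \<Rightarrow> real) \<Rightarrow> 'c \<Rightarrow> real \<Rightarrow> 'c berk_point" where
  "zeta v a r = Some (\<lambda>f. SUP z\<in>{z. v (z - a) \<le> r}. v (poly f z))"

definition type_II :: "('c::field \<Rightarrow> real) \<Rightarrow> 'c berk_point \<Rightarrow> bool" where
  "type_II v \<xi> \<longleftrightarrow> (\<exists>a. \<exists>r\<in>v ` (UNIV - {0}). \<xi> = zeta v a r)"

definition berk_components :: "('c::field \<Rightarrow> real) \<Rightarrow> 'c berk_point \<Rightarrow> 'c berk_point set set" where
  "berk_components v \<xi> =
     connected_components_of (subtopology (berk_line v) (topspace (berk_line v) - {\<xi>}))"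


section \<open>Rational functions\<close>

text \<open>
  A rational function of degree \<open>d\<close> over \<open>F\<close>, as a quotient $p/q$ in lowest terms. Coprimality is
  stated over the big field; it does not depend on the field.
\<close>

definition rational_function :: "'c::field set \<Rightarrow> 'c poly \<Rightarrow> 'c poly \<Rightarrow> nat \<Rightarrow> bool" where
  "rational_function F p q d \<longleftrightarrow>
     (\<forall>i. poly.coeff p i \<in> F) \<and> (\<forall>i. poly.coeff q i \<in> F) \<and>
     q \<noteq> 0 \<and> coprime p q \<and> d = max (Polynomial.degree p) (Polynomial.degree q)"

definition rat_map :: "'c::field poly \<Rightarrow> 'c poly \<Rightarrow> 'c option \<Rightarrow> 'c option" where
  "rat_map p q x = (case x of
     Some a \<Rightarrow> (if poly q a = 0 then None else Some (poly p a / poly q a))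
   | None \<Rightarrow> (if Polynomial.degree q < Polynomial.degree p then None
              else Some (poly.coeff p (Polynomial.degree q) / Polynomial.lead_coeff q)))"

text \<open>
  \<open>clear_denom p q n f\<close> is $q^n \cdot f(p/q)$, for $n \geq \deg f$.
\<close>

definition clear_denom :: "'c::field poly \<Rightarrow> 'c poly \<Rightarrow> nat \<Rightarrow> 'c poly \<Rightarrow> 'c poly" where
  "clear_denom p q n f = (\<Sum>i\<le>n. Polynomial.smult (poly.coeff f i) (p ^ i * q ^ (n - i)))"

text \<open>
  The action of $\phi = p/q$ on the Berkovich line sends a seminorm \<open>s\<close> to $f \mapsto s(f\circ\phi)$,
  where \<open>s\<close> is extended multiplicatively to fractions whose denominator does not have seminorm
  \<open>0\<close>. If $s(q) = 0$ then \<open>s\<close> is a pole of $\phi$. It is proved below that for coprime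
  \<open>p\<close> and \<open>q\<close> this is a continuous self-map that extends \<open>rat_map p q\<close>.
\<close>

definition berk_push :: "'c::field poly \<Rightarrow> 'c poly \<Rightarrow> ('c poly \<Rightarrow> real) \<Rightarrow> 'c poly \<Rightarrow> real" where
  "berk_push p q s f =
     s (clear_denom p q (Polynomial.degree f) f) / s q ^ Polynomial.degree f"

definition berk_map ::
    "('c::field \<Rightarrow> real) \<Rightarrow> 'c poly \<Rightarrow> 'c poly \<Rightarrow> 'c berk_point \<Rightarrow> 'c berk_point" where
  "berk_map v p q x = (case x of
     Some s \<Rightarrow> (if s q = 0 then None else Some (berk_push p q s))
   | None \<Rightarrow> type_I v (rat_map p q None))"

definition totally_invariant ::
    "('c::field \<Rightarrow> real) \<Rightarrow> 'c poly \<Rightarrow> 'c poly \<Rightarrow> 'c berk_point \<Rightarrow> bool" where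
  "totally_invariant v p q \<xi> \<longleftrightarrow>
     {x \<in> topspace (berk_line v). berk_map v p q x = \<xi>} = {\<xi>}"


section \<open>The action is a continuous extension\<close>

subsection \<open>Seminorms\<close>

context nonarch_abs_value
begin

lemma v_0 [simp]: "v 0 = 0" using v_eq_0_iff by simp

lemma v_1 [simp]: "v 1 = 1"
proof -
  have "v 1 * v 1 = v 1 * 1" using v_mult[of 1 1] by simp
  moreover have "v 1 \<noteq> 0" using v_eq_0_iff by simp
  ultimately show ?thesis by (metis mult_cancel_left)
qed

lemma v_power: "v (x ^ n) = v x ^ n"
  by (induction n) (simp_all add: v_mult)

lemma v_inverse: "v (inverse x) = inverse (v x)"
proof (cases "x = 0")
  case False
  then have "v x * v (inverse x) = 1" using v_mult[of x "inverse x"] by simp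
  then show ?thesis by (metis inverse_unique)
qed simp

lemma v_divide: "v (x / y) = v x / v y"
  by (simp add: divide_inverse v_mult v_inverse)

context
  fixes s assumes s: "berk_seminorm v s"
begin

lemma sn_nonneg: "0 \<le> s f" and sn_add: "s (f + g) \<le> s f + s g"
  and sn_mult: "s (f * g) = s f * s g" and sn_const: "s [:c:] = v c"
  using s by (auto simp: berk_seminorm_def)

lemma sn_0: "s 0 = 0" using sn_const[of 0] by simp

lemma sn_1: "s 1 = 1" using sn_const[of 1] by (simp add: one_pCons)

lemma sn_power: "s (f ^ n) = s f ^ n"
  by (induction n) (simp_all add: sn_1 sn_mult)

lemma sn_smult: "s (Polynomial.smult c f) = v c * s f"
  using sn_mult[of "[:c:]" f] by (simp add: sn_const)

lemma sn_sum: "finite A \<Longrightarrow> s (sum f A) \<le> (\<Sum>i\<in>A. s (f i))"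
proof (induction A rule: finite_induct)
  case (insert a A)
  then show ?case using sn_add[of "f a" "sum f A"] by simp
qed (simp add: sn_0)

lemma sn_minus: "s (- f) = s f"
proof -
  have "v (-1) * v (-1) = 1" using v_mult[of "-1" "-1"] by simp
  then have "v (-1) = 1" using v_nonneg[of "-1"]
    by (metis abs_of_nonneg power2_eq_square real_sqrt_abs real_sqrt_one)
  then show ?thesis using sn_smult[of "-1" f] by simp
qed

lemma sn_diff_le: "\<bar>s f - s g\<bar> \<le> s (f - g)"
  using sn_add[of "f - g" g] sn_add[of "g - f" f] sn_minus[of "f - g"] by simp

text \<open>The leading term dominates for large values of \<open>s [:0, 1:]\<close>.\<close>

lemma sn_asymp:
  assumes "Polynomial.degree f \<le> n" and T: "1 \<le> s [:0, 1:]"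
  shows "\<bar>s f / s [:0, 1:] ^ n - v (poly.coeff f n)\<bar> \<le>
           (\<Sum>i<n. v (poly.coeff f i)) / s [:0, 1:]"
proof -
  let ?T = "s [:0, 1:]"
  have mon: "s (Polynomial.monom c i) = v c * ?T ^ i" for c i
    by (simp add: monom_altdef sn_smult sn_power)
  have "f = (\<Sum>i\<le>n. Polynomial.monom (poly.coeff f i) i)"
    by (metis assms(1) poly_as_sum_of_monoms')
  also have "\<dots> = (\<Sum>i<n. Polynomial.monom (poly.coeff f i) i) + Polynomial.monom (poly.coeff f n) n"
    by (simp add: lessThan_Suc_atMost[symmetric])
  finally have f: "f - Polynomial.monom (poly.coeff f n) n = (\<Sum>i<n. Polynomial.monom (poly.coeff f i) i)"
    by (metis add_diff_cancel_right')
  have "\<bar>s f - v (poly.coeff f n) * ?T ^ n\<bar> \<le> s (f - Polynomial.monom (poly.coeff f n) n)"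
    using sn_diff_le mon by metis
  also have "\<dots> \<le> (\<Sum>i<n. v (poly.coeff f i) * ?T ^ i)"
    unfolding f using sn_sum[of "{..<n}" "\<lambda>i. Polynomial.monom (poly.coeff f i) i"] by (simp add: mon)
  also have "\<dots> \<le> (\<Sum>i<n. v (poly.coeff f i) * (?T ^ n / ?T))"
  proof (intro sum_mono mult_left_mono v_nonneg)
    fix i assume "i \<in> {..<n}"
    then obtain m where m: "n = Suc m" and "i \<le> m" by (cases n) auto
    then have "?T ^ i \<le> ?T ^ m" using T by (intro power_increasing) auto
    also have "\<dots> = ?T ^ n / ?T" using T by (simp add: m)
    finally show "?T ^ i \<le> ?T ^ n / ?T" .
  qed
  finally have "\<bar>s f - v (poly.coeff f n) * ?T ^ n\<bar> \<le> (\<Sum>i<n. v (poly.coeff f i)) * (?T ^ n / ?T)"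
    by (simp only: sum_distrib_right)
  then have "\<bar>s f - v (poly.coeff f n) * ?T ^ n\<bar> / ?T ^ n \<le> (\<Sum>i<n. v (poly.coeff f i)) / ?T"
    using T by (simp add: field_simps)
  moreover have "\<bar>s f - v (poly.coeff f n) * ?T ^ n\<bar> / ?T ^ n = \<bar>s f / ?T ^ n - v (poly.coeff f n)\<bar>"
  proof -
    have "s f / ?T ^ n - v (poly.coeff f n) = (s f - v (poly.coeff f n) * ?T ^ n) / ?T ^ n"
      using T by (simp add: field_simps)
    then show ?thesis using T by (simp add: abs_divide)
  qed
  ultimately show ?thesis by simp
qed

lemma sn_bound: "s f \<le> (\<Sum>i\<le>Polynomial.degree f. v (poly.coeff f i) * s [:0, 1:] ^ i)"
proof -
  have "s f = s (\<Sum>i\<le>Polynomial.degree f. Polynomial.monom (poly.coeff f i) i)"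
    by (simp add: poly_as_sum_of_monoms)
  also have "\<dots> \<le> (\<Sum>i\<le>Polynomial.degree f. s (Polynomial.monom (poly.coeff f i) i))"
    by (intro sn_sum) auto
  also have "\<dots> = (\<Sum>i\<le>Polynomial.degree f. v (poly.coeff f i) * s [:0, 1:] ^ i)"
    by (simp add: monom_altdef sn_smult sn_power)
  finally show ?thesis .
qed

end

lemma berk_seminorm_eval: "berk_seminorm v (\<lambda>f. v (poly f a))"
  unfolding berk_seminorm_def
proof (intro conjI allI)
  fix f g
  show "v (poly (f + g) a) \<le> v (poly f a) + v (poly g a)"
    using v_add[of "poly f a" "poly g a"] v_nonneg[of "poly f a"] v_nonneg[of "poly g a"] by simp
qed (auto simp: v_nonneg v_mult)

lemma topspace_berk_line:
  "topspace (berk_line v) = insert None (Some ` {s. berk_seminorm v s})"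
  by (simp add: berk_line_def berk_affine_def)

lemma type_I_in_berk_line: "type_I v x \<in> topspace (berk_line v)"
  by (cases x) (auto simp: type_I_def topspace_berk_line berk_seminorm_eval)

lemma inj_type_I: "inj (type_I v)"
proof (rule injI)
  fix x y assume eq: "type_I v x = type_I v y"
  show "x = y"
  proof (cases x; cases y)
    fix a b assume xy: "x = Some a" "y = Some b"
    then have "v (poly f a) = v (poly f b)" for f using eq by (auto simp: type_I_def dest: fun_cong)
    from this[of "[:-a, 1:]"] show ?thesis by (auto simp: v_eq_0_iff xy)
  qed (use eq in \<open>auto simp: type_I_def\<close>)
qed

end


subsection \<open>Clearing denominators\<close>

lemma coprime_poly_bezout:
  fixes p q :: "'a::field poly"
  assumes "coprime p q"
  shows "\<exists>a b. a * p + b * q = 1"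
proof -
  have "\<exists>a b. a * p + b * q dvd p \<and> a * p + b * q dvd q" for p q :: "'a poly"
  proof (induction "if q = 0 then 0 else Suc (Polynomial.degree q)" arbitrary: p q rule: less_induct)
    case less
    show ?case
    proof (cases "q = 0")
      case True
      then have "1 * p + 0 * q dvd p \<and> 1 * p + 0 * q dvd q" by simp
      then show ?thesis by blast
    next
      case False
      then have "(if p mod q = 0 then 0 else Suc (Polynomial.degree (p mod q))) <
                 (if q = 0 then 0 else Suc (Polynomial.degree q))"
        using degree_mod_less[of q p] by auto
      from less[OF this] obtain a b where
        ab: "a * q + b * (p mod q) dvd q" "a * q + b * (p mod q) dvd p mod q" by blast
      have "a * q + b * (p mod q) = b * p + (a - b * (p div q)) * q"
        by (simp add: algebra_simps minus_mult_div_eq_mod[symmetric])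
      moreover have "a * q + b * (p mod q) dvd p"
        using ab by (metis dvd_mod_imp_dvd)
      ultimately show ?thesis using ab(1) by metis
    qed
  qed
  then obtain a b where "a * p + b * q dvd p" "a * p + b * q dvd q" by blast
  then have "a * p + b * q dvd 1" using assms by (meson coprime_common_divisor)
  then obtain c where "1 = (a * p + b * q) * c" by (elim dvdE)
  then have "(c * a) * p + (c * b) * q = 1" by (simp add: algebra_simps)
  then show ?thesis by blast
qed

lemma to_fract_power: "to_fract (x ^ n) = to_fract x ^ n"
  by (induction n) auto

lemma to_fract_sum: "to_fract (sum f A) = (\<Sum>i\<in>A. to_fract (f i))"
  by (induction A rule: infinite_finite_induct) auto

context
  fixes p q :: "'c::field poly"
  assumes q0: "q \<noteq> 0"
begin

definition subst_fract :: "'c poly \<Rightarrow> 'c poly fract" where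
  "subst_fract f = (\<Sum>i\<le>Polynomial.degree f. to_fract [:poly.coeff f i:] * (to_fract p / to_fract q) ^ i)"

lemma subst_fract_altdef:
  assumes "Polynomial.degree f \<le> n"
  shows "subst_fract f = (\<Sum>i\<le>n. to_fract [:poly.coeff f i:] * (to_fract p / to_fract q) ^ i)"
  unfolding subst_fract_def
  by (rule sum.mono_neutral_left) (use assms in \<open>auto simp: coeff_eq_0\<close>)

lemma clear_denom_fract:
  assumes "Polynomial.degree f \<le> n"
  shows "to_fract (clear_denom p q n f) = subst_fract f * to_fract q ^ n"
proof -
  have "to_fract (Polynomial.smult (poly.coeff f i) (p ^ i * q ^ (n - i))) =
        to_fract [:poly.coeff f i:] * (to_fract p / to_fract q) ^ i * to_fract q ^ n" if "i \<le> n" for i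
  proof -
    have "Polynomial.smult (poly.coeff f i) (p ^ i * q ^ (n - i)) = [:poly.coeff f i:] * (p ^ i * q ^ (n - i))"
      by simp
    also have "to_fract \<dots> = to_fract [:poly.coeff f i:] * (to_fract p ^ i * to_fract q ^ (n - i))"
      by (simp only: to_fract_mult to_fract_power)
    also have "to_fract q ^ (n - i) = to_fract q ^ n / to_fract q ^ i"
      using q0 that by (simp add: power_diff)
    finally show ?thesis by (simp add: power_divide)
  qed
  then show ?thesis
    unfolding subst_fract_altdef[OF assms] clear_denom_def to_fract_sum sum_distrib_right
    by (intro sum.cong) auto
qed

lemma subst_fract_add: "subst_fract (f + g) = subst_fract f + subst_fract g"
proof -
  let ?n = "max (Polynomial.degree f) (Polynomial.degree g)"
  have c: "[:a + b:] = [:a:] + [:b:]" for a b :: 'c by simp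
  have "Polynomial.degree (f + g) \<le> ?n" by (rule degree_add_le_max)
  then show ?thesis
    by (simp only: subst_fract_altdef[of _ ?n] max.cobounded1 max.cobounded2 coeff_add c to_fract_add
      distrib_right sum.distrib)
qed

lemma subst_fract_pCons: "subst_fract (pCons a f) = to_fract [:a:] + to_fract p / to_fract q * subst_fract f"
proof -
  have "Polynomial.degree (pCons a f) \<le> Suc (Polynomial.degree f)" by (rule degree_pCons_le)
  then show ?thesis
    by (simp add: subst_fract_altdef[of "pCons a f"] subst_fract_def sum.atMost_Suc_shift sum_distrib_left
        mult_ac del: sum.atMost_Suc)
qed

lemma subst_fract_smult: "subst_fract (Polynomial.smult c f) = to_fract [:c:] * subst_fract f"
proof -
  have c: "[:a * b:] = [:a:] * [:b:]" for a b :: 'c by simp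
  show ?thesis
    unfolding subst_fract_altdef[OF degree_smult_le]
    by (simp only: subst_fract_def coeff_smult c to_fract_mult sum_distrib_left mult.assoc)
qed

lemma subst_fract_mult: "subst_fract (f * g) = subst_fract f * subst_fract g"
proof (induction f)
  case 0
  then show ?case by (simp add: subst_fract_def)
next
  case (pCons a f)
  have z: "subst_fract (pCons 0 h) = to_fract p / to_fract q * subst_fract h" for h
    by (simp add: subst_fract_pCons)
  show ?case
    by (simp only: mult_pCons_left subst_fract_add z subst_fract_smult pCons.IH subst_fract_pCons[of a f]
      distrib_right mult.assoc)
qed

end


subsection \<open>The action on seminorms\<close>

context nonarch_abs_value
begin

lemma push_eq:
  assumes s: "berk_seminorm v s" and "s q \<noteq> 0" and n: "Polynomial.degree f \<le> n"
  shows "berk_push p q s f = s (clear_denom p q n f) / s q ^ n"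
proof -
  have q0: "q \<noteq> 0" using assms sn_0[OF s] by auto
  let ?d = "Polynomial.degree f"
  have "to_fract (clear_denom p q n f) = to_fract (clear_denom p q ?d f * q ^ (n - ?d))"
    unfolding to_fract_mult to_fract_power clear_denom_fract[OF q0 n] clear_denom_fract[OF q0 order.refl]
    using n by (simp add: mult.assoc to_fract_power power_add[symmetric])
  then have "clear_denom p q n f = clear_denom p q ?d f * q ^ (n - ?d)" by (simp only: to_fract_eq_iff)
  then have "s (clear_denom p q n f) = s (clear_denom p q ?d f) * s q ^ (n - ?d)"
    by (simp add: sn_mult[OF s] sn_power[OF s])
  then show ?thesis
    using assms by (simp add: berk_push_def power_diff field_simps)
qed

lemma push_seminorm:
  assumes s: "berk_seminorm v s" and sq: "s q \<noteq> 0"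
  shows "berk_seminorm v (berk_push p q s)"
  unfolding berk_seminorm_def
proof (intro conjI allI)
  have q0: "q \<noteq> 0" using assms sn_0[OF s] by auto
  fix f g :: "'c poly" and c
  show "0 \<le> berk_push p q s f" by (simp add: berk_push_def sn_nonneg[OF s])
  show "berk_push p q s [:c:] = v c"
    by (simp add: berk_push_def clear_denom_def sn_const[OF s])
  let ?n = "max (Polynomial.degree f) (Polynomial.degree g)"
  have "clear_denom p q ?n (f + g) = clear_denom p q ?n f + clear_denom p q ?n g"
    by (simp add: clear_denom_def smult_add_left sum.distrib)
  moreover have "Polynomial.degree (f + g) \<le> ?n" by (rule degree_add_le_max)
  ultimately show "berk_push p q s (f + g) \<le> berk_push p q s f + berk_push p q s g"
    using sn_add[OF s, of "clear_denom p q ?n f" "clear_denom p q ?n g"] sn_nonneg[OF s, of q]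
    by (simp add: push_eq[OF s sq, where n = ?n] add_divide_distrib[symmetric] divide_right_mono)
  let ?d = "Polynomial.degree f" and ?e = "Polynomial.degree g"
  have de: "Polynomial.degree (f * g) \<le> ?d + ?e" by (rule degree_mult_le)
  have "to_fract (clear_denom p q (?d + ?e) (f * g)) =
        to_fract (clear_denom p q ?d f * clear_denom p q ?e g)"
    unfolding to_fract_mult clear_denom_fract[OF q0 de] clear_denom_fract[OF q0 order.refl]
      subst_fract_mult[OF q0] by (simp add: power_add mult_ac)
  then have "clear_denom p q (?d + ?e) (f * g) = clear_denom p q ?d f * clear_denom p q ?e g"
    by (simp only: to_fract_eq_iff)
  then show "berk_push p q s (f * g) = berk_push p q s f * berk_push p q s g"
    by (simp add: push_eq[OF s sq de] berk_push_def[of p q s f] berk_push_def[of p q s g] sn_mult[OF s] power_add)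
qed

lemma berk_map_type_I: "berk_map v p q (type_I v x) = type_I v (rat_map p q x)"
proof (cases x)
  case None
  then show ?thesis by (simp add: type_I_def berk_map_def)
next
  case (Some a)
  show ?thesis
  proof (cases "poly q a = 0")
    case True
    then show ?thesis by (simp add: Some type_I_def berk_map_def rat_map_def)
  next
    case False
    have "poly (clear_denom p q n f) a / poly q a ^ n = poly f (poly p a / poly q a)"
      if n: "n = Polynomial.degree f" for f n
    proof -
      have "poly (clear_denom p q n f) a / poly q a ^ n =
            (\<Sum>i\<le>n. poly.coeff f i * (poly p a ^ i * poly q a ^ (n - i)) / poly q a ^ n)"
        by (simp add: clear_denom_def poly_sum sum_divide_distrib)
      also have "\<dots> = (\<Sum>i\<le>n. poly.coeff f i * (poly p a / poly q a) ^ i)"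
        using False by (intro sum.cong) (auto simp: power_diff power_divide)
      finally show ?thesis by (simp add: n poly_altdef)
    qed
    then have "v (poly (clear_denom p q (Polynomial.degree f) f) a) / v (poly q a) ^ Polynomial.degree f =
          v (poly f (poly p a / poly q a))" for f
      by (metis v_divide v_power)
    with False show ?thesis
      by (simp add: Some type_I_def berk_map_def rat_map_def berk_push_def fun_eq_iff v_eq_0_iff)
  qed
qed

lemma berk_map_in_berk_line:
  assumes "x \<in> topspace (berk_line v)"
  shows "berk_map v p q x \<in> topspace (berk_line v)"
proof (cases x)
  case None
  then show ?thesis by (simp add: berk_map_def type_I_in_berk_line)
next
  case (Some s)
  with assms have "berk_seminorm v s" by (auto simp: topspace_berk_line)
  then show ?thesis by (auto simp: Some berk_map_def topspace_berk_line push_seminorm)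
qed

end


subsection \<open>Continuity of the action\<close>

lemma coeff_mult_top:
  fixes f g :: "'a::field poly"
  assumes "Polynomial.degree f \<le> m" "Polynomial.degree g \<le> n"
  shows "poly.coeff (f * g) (m + n) = poly.coeff f m * poly.coeff g n"
proof (cases "Polynomial.degree f = m \<and> Polynomial.degree g = n")
  case True
  then show ?thesis using coeff_mult_degree_sum[of f g] by simp
next
  case False
  then have "Polynomial.degree f + Polynomial.degree g < m + n" using assms by auto
  then have "poly.coeff (f * g) (m + n) = 0"
    using degree_mult_le[of f g] by (intro coeff_eq_0) linarith
  then show ?thesis using False assms by (auto simp: coeff_eq_0)
qed

lemma coeff_power_top:
  fixes f :: "'a::field poly"
  assumes "Polynomial.degree f \<le> m"
  shows "poly.coeff (f ^ i) (m * i) = poly.coeff f m ^ i \<and> Polynomial.degree (f ^ i) \<le> m * i"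
proof -
  have "Polynomial.degree (f ^ i) \<le> m * i" for i
    using degree_power_le[of f i] mult_le_mono1[OF assms, of i] by linarith
  moreover have "poly.coeff (f ^ i) (m * i) = poly.coeff f m ^ i"
  proof (induction i)
    case (Suc i)
    then show ?case using coeff_mult_top[OF assms \<open>Polynomial.degree (f ^ i) \<le> m * i\<close>] by simp
  qed simp
  ultimately show ?thesis by blast
qed

lemma clear_denom_top:
  fixes p q f :: "'a::field poly"
  assumes pq: "Polynomial.degree p \<le> Polynomial.degree q" and q0: "q \<noteq> 0"
  defines "m \<equiv> Polynomial.degree q" and "N \<equiv> Polynomial.degree f"
  shows "poly.coeff (clear_denom p q N f) (m * N) =
           poly f (poly.coeff p m / poly.coeff q m) * poly.coeff q m ^ N"
    and "Polynomial.degree (clear_denom p q N f) \<le> m * N"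
proof -
  have top: "poly.coeff (p ^ i * q ^ (N - i)) (m * N) = poly.coeff p m ^ i * poly.coeff q m ^ (N - i)
      \<and> Polynomial.degree (p ^ i * q ^ (N - i)) \<le> m * N" if "i \<le> N" for i
  proof -
    have "m * N = m * i + m * (N - i)" using that by (simp add: distrib_left[symmetric])
    moreover have "Polynomial.degree p \<le> m" "Polynomial.degree q \<le> m" using pq by (auto simp: m_def)
    ultimately show ?thesis
      using coeff_power_top[of p m i] coeff_power_top[of q m "N - i"]
        coeff_mult_top[of "p ^ i" "m * i" "q ^ (N - i)" "m * (N - i)"]
        degree_mult_le[of "p ^ i" "q ^ (N - i)"] by auto
  qed
  have lc: "poly.coeff q m \<noteq> 0" using q0 by (simp add: m_def)
  have "poly.coeff (clear_denom p q N f) (m * N) =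
        (\<Sum>i\<le>N. poly.coeff f i * (poly.coeff p m ^ i * poly.coeff q m ^ (N - i)))"
    by (simp add: clear_denom_def coeff_sum top)
  also have "\<dots> = (\<Sum>i\<le>N. poly.coeff f i * (poly.coeff p m / poly.coeff q m) ^ i * poly.coeff q m ^ N)"
    using lc by (intro sum.cong) (auto simp: power_diff power_divide)
  finally show "poly.coeff (clear_denom p q N f) (m * N) =
           poly f (poly.coeff p m / poly.coeff q m) * poly.coeff q m ^ N"
    by (simp add: poly_altdef sum_distrib_right N_def)
  show "Polynomial.degree (clear_denom p q N f) \<le> m * N"
    unfolding clear_denom_def
    by (intro degree_sum_le) (auto intro: order.trans[OF degree_smult_le] simp: top)
qed

context nonarch_abs_value
begin

lemma topspace_berk_affine: "topspace (berk_affine v) = {s. berk_seminorm v s}"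
  by (simp add: berk_affine_def)

lemma continuous_eval: "continuous_map (berk_affine v) euclideanreal (\<lambda>s. s f)"
  unfolding berk_affine_def
  by (intro continuous_map_from_subtopology continuous_map_product_projection) simp

lemma limitin_berk_affine:
  "limitin (berk_affine v) g l G \<longleftrightarrow>
     berk_seminorm v l \<and> eventually (\<lambda>a. berk_seminorm v (g a)) G \<and> (\<forall>f. ((\<lambda>a. g a f) \<longlongrightarrow> l f) G)"
  by (auto simp: berk_affine_def limitin_subtopology limitin_componentwise)

lemma bounded_affine_compact:
  fixes R :: real
  defines "C \<equiv> {s. berk_seminorm v s \<and> s [:0, 1:] \<le> R}"
  shows "compactin (berk_affine v) C" and "closedin (berk_affine v) C"
proof -
  let ?X = "powertop_real (UNIV :: 'c poly set)"
  let ?B = "\<lambda>f. \<Sum>i\<le>Polynomial.degree f. v (poly.coeff f i) * max 0 R ^ i"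
  have ev [continuous_intros]: "continuous_map ?X euclideanreal (\<lambda>s. s f)" for f
    by (intro continuous_map_product_projection) simp
  have comp: "compactin ?X (\<Pi>\<^sub>E f\<in>UNIV. {0..?B f})"
    unfolding compactin_PiE by auto
  have le: "closedin ?X {s. h s \<le> k s}"
    if "continuous_map ?X euclideanreal h" "continuous_map ?X euclideanreal k" for h k
  proof -
    have "closedin ?X {s \<in> topspace ?X. k s - h s \<in> {0..}}"
      using that by (intro closedin_continuous_map_preimage[where Y = euclideanreal] continuous_intros) auto
    then show ?thesis by simp
  qed
  have "C = (\<Inter>f. {s. 0 \<le> s f}) \<inter> (\<Inter>f. \<Inter>g. {s. s (f + g) \<le> s f + s g}) \<inter>
            (\<Inter>f. \<Inter>g. {s. s (f * g) \<le> s f * s g}) \<inter> (\<Inter>f. \<Inter>g. {s. s f * s g \<le> s (f * g)}) \<inter>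
            (\<Inter>c. {s. s [:c:] \<le> v c}) \<inter> (\<Inter>c. {s. v c \<le> s [:c:]}) \<inter> {s. s [:0, 1:] \<le> R}"
    by (auto simp: C_def berk_seminorm_def intro!: antisym)
  moreover have "closedin ?X \<dots>"
    by (intro closedin_Int closedin_INT le continuous_intros) auto
  ultimately have cl: "closedin ?X C" by simp
  have "C \<subseteq> (\<Pi>\<^sub>E f\<in>UNIV. {0..?B f})"
  proof
    fix s assume "s \<in> C"
    then have s: "berk_seminorm v s" and R: "s [:0, 1:] \<le> R" by (auto simp: C_def)
    have "s f \<le> ?B f" for f
    proof -
      have "s f \<le> (\<Sum>i\<le>Polynomial.degree f. v (poly.coeff f i) * s [:0, 1:] ^ i)"
        by (rule sn_bound[OF s])
      also have "\<dots> \<le> ?B f"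
        using R sn_nonneg[OF s] by (intro sum_mono mult_left_mono power_mono v_nonneg) auto
      finally show ?thesis .
    qed
    then show "s \<in> (\<Pi>\<^sub>E f\<in>UNIV. {0..?B f})" using sn_nonneg[OF s] by auto
  qed
  then have "compactin ?X C" using closed_compactin[OF comp _ cl] by blast
  then show "compactin (berk_affine v) C"
    by (auto simp: berk_affine_def compactin_subtopology C_def)
  have "C \<subseteq> {s. berk_seminorm v s}" by (auto simp: C_def)
  with cl show "closedin (berk_affine v) C"
    unfolding berk_affine_def by (meson closedin_subset_topspace)
qed

lemma eventually_atin_Some:
  assumes s: "berk_seminorm v s" and "eventually (\<lambda>t. P (Some t)) (atin (berk_affine v) s)"
  shows "eventually P (atin (berk_line v) (Some s))"
proof -
  obtain U where U: "openin (berk_affine v) U" "s \<in> U" "\<forall>t\<in>U - {s}. P (Some t)"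
    using assms by (auto simp: eventually_atin topspace_berk_affine)
  have "openin (berk_line v) (Some ` U)" using U by (simp add: berk_line_def)
  then show ?thesis using U unfolding eventually_atin by (intro disjI2 exI[of _ "Some ` U"]) auto
qed

definition at_infty :: "('c poly \<Rightarrow> real) filter" where
  "at_infty = inf (filtercomap (\<lambda>s. s [:0, 1:]) at_top) (principal {s. berk_seminorm v s})"

lemma eventually_at_infty_seminorm: "eventually (berk_seminorm v) at_infty"
  by (simp add: at_infty_def eventually_inf_principal)

lemma filterlim_at_infty: "filterlim (\<lambda>s. s [:0, 1:]) at_top at_infty"
  unfolding at_infty_def by (rule filterlim_mono[OF filterlim_filtercomap order.refl inf_le1])

lemma eventually_atin_None:
  assumes "eventually (\<lambda>t. P (Some t)) at_infty"
  shows "eventually P (atin (berk_line v) None)"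
proof -
  obtain R where R: "\<And>s. berk_seminorm v s \<Longrightarrow> R < s [:0, 1:] \<Longrightarrow> P (Some s)"
  proof -
    have "eventually (\<lambda>t. berk_seminorm v t \<longrightarrow> P (Some t)) (filtercomap (\<lambda>s. s [:0, 1:]) at_top)"
      using assms by (simp add: at_infty_def eventually_inf_principal)
    then obtain Q where "eventually Q at_top" and Q: "\<And>t. Q (t [:0, 1:]) \<Longrightarrow> berk_seminorm v t \<Longrightarrow> P (Some t)"
      by (auto simp: eventually_filtercomap)
    then obtain R where "\<And>x. R < x \<Longrightarrow> Q x" by (auto simp: eventually_at_top_dense)
    with Q that show ?thesis by blast
  qed
  let ?C = "{s. berk_seminorm v s \<and> s [:0, 1:] \<le> R}"
  have "openin (berk_line v) (insert None (Some ` (topspace (berk_affine v) - ?C)))"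
    unfolding berk_line_def openin_Alexandroff_compactification
    using bounded_affine_compact[of R] by blast
  then show ?thesis
    unfolding eventually_atin using R
    by (intro disjI2 exI[of _ "insert None (Some ` (topspace (berk_affine v) - ?C))"])
       (auto simp: topspace_berk_affine not_less, metis not_less)
qed

lemma tendsto_at_infty:
  assumes "Polynomial.degree f \<le> n"
  shows "((\<lambda>s. s f / s [:0, 1:] ^ n) \<longlongrightarrow> v (poly.coeff f n)) at_infty"
proof -
  let ?c = "\<Sum>i<n. v (poly.coeff f i)"
  have "((\<lambda>s. ?c / s [:0, 1:]) \<longlongrightarrow> 0) at_infty"
    by (intro tendsto_divide_0[OF tendsto_const] filterlim_at_top_imp_at_infinity filterlim_at_infty)
  moreover have "eventually (\<lambda>s. norm (s f / s [:0, 1:] ^ n - v (poly.coeff f n)) \<le> ?c / s [:0, 1:]) at_infty"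
    using eventually_at_infty_seminorm filterlim_at_infty[unfolded filterlim_at_top, rule_format, of 1]
  proof eventually_elim
    case (elim s)
    then show ?case using sn_asymp[OF _ assms] by simp
  qed
  ultimately have "((\<lambda>s. s f / s [:0, 1:] ^ n - v (poly.coeff f n)) \<longlongrightarrow> 0) at_infty"
    by (rule Lim_null_comparison[rotated])
  then show ?thesis by (simp add: LIM_zero_iff)
qed

lemma limitin_berk_map_Some:
  assumes ev: "eventually (berk_seminorm v) G" "eventually (\<lambda>s. s q \<noteq> 0) G"
    and l: "berk_seminorm v l" and lim: "\<And>f. ((\<lambda>s. berk_push p q s f) \<longlongrightarrow> l f) G"
  shows "limitin (berk_line v) (\<lambda>s. berk_map v p q (Some s)) (Some l) G"
proof -
  have "eventually (\<lambda>s. berk_seminorm v (berk_push p q s)) G"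
    using ev by eventually_elim (rule push_seminorm)
  with l lim have "limitin (berk_affine v) (\<lambda>s. berk_push p q s) l G"
    by (simp add: limitin_berk_affine)
  from continuous_map_limit[OF continuous_map_Some this]
  have "limitin (berk_line v) (\<lambda>s. Some (berk_push p q s)) (Some l) G"
    by (simp add: berk_line_def o_def)
  then show ?thesis
    by (rule limitin_transform_eventually[rotated])
       (use ev(2) in eventually_elim, simp add: berk_map_def)
qed

lemma limitin_berk_map_None:
  assumes ev: "eventually (berk_seminorm v) G" and lim: "\<And>M. eventually (\<lambda>s. M * s q < s p) G"
  shows "limitin (berk_line v) (\<lambda>s. berk_map v p q (Some s)) None G"
  unfolding limitin_def
proof (intro conjI allI impI)
  show "None \<in> topspace (berk_line v)" by (simp add: topspace_berk_line)
  fix W assume "openin (berk_line v) W \<and> None \<in> W"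
  then obtain C where C: "compactin (berk_affine v) C"
    and W: "W = insert None (Some ` (topspace (berk_affine v) - C))"
    by (auto simp: berk_line_def openin_Alexandroff_compactification)
  have "compactin euclideanreal ((\<lambda>s. s [:0, 1:]) ` C)"
    by (rule image_compactin[OF C continuous_eval])
  then have "bounded ((\<lambda>s. s [:0, 1:]) ` C)" by (simp add: compact_imp_bounded)
  then obtain M where M: "\<And>s. s \<in> C \<Longrightarrow> s [:0, 1:] \<le> M"
    by (auto simp: bounded_iff) (meson abs_le_D1)
  show "eventually (\<lambda>s. berk_map v p q (Some s) \<in> W) G"
    using ev lim[of M]
  proof eventually_elim
    case (elim s)
    show ?case
    proof (cases "s q = 0")
      case True
      then show ?thesis by (simp add: berk_map_def W)
    next
      case False
      then have "0 < s q" using sn_nonneg[OF elim(1), of q] by simp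
      then have "M < s p / s q" using elim(2) by (simp add: field_simps)
      also have "s p / s q = berk_push p q s [:0, 1:]"
        by (simp add: berk_push_def clear_denom_def)
      finally have "berk_push p q s \<notin> C" using M by force
      then show ?thesis
        using push_seminorm[OF elim(1) False] False by (auto simp: berk_map_def W topspace_berk_affine)
    qed
  qed
qed

lemma continuous_berk_map:
  assumes "q \<noteq> 0" "coprime p q"
  shows "continuous_map (berk_line v) (berk_line v) (berk_map v p q)"
  unfolding continuous_map_atin
proof
  fix x assume x: "x \<in> topspace (berk_line v)"
  show "limitin (berk_line v) (berk_map v p q) (berk_map v p q x) (atin (berk_line v) x)"
  proof (cases x)
    case (Some s)
    with x have s: "berk_seminorm v s" by (auto simp: topspace_berk_line)
    let ?G = "atin (berk_affine v) s"
    have "limitin (berk_affine v) (\<lambda>t. t) s ?G"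
      using s by (intro limitin_continuous_map) (auto simp: topspace_berk_affine)
    then have ev: "eventually (berk_seminorm v) ?G" and lim [tendsto_intros]: "\<And>f. ((\<lambda>t. t f) \<longlongrightarrow> s f) ?G"
      by (simp_all add: limitin_berk_affine)
    have "limitin (berk_line v) (\<lambda>t. berk_map v p q (Some t)) (berk_map v p q (Some s)) ?G"
    proof (cases "s q = 0")
      case False
      have "((\<lambda>t. berk_push p q t f) \<longlongrightarrow> berk_push p q s f) ?G" for f
        unfolding berk_push_def using False by (intro tendsto_intros) auto
      moreover have "eventually (\<lambda>t. t q \<noteq> 0) ?G" using lim False by (rule tendsto_imp_eventually_ne)
      ultimately show ?thesis
        using limitin_berk_map_Some[OF ev _ push_seminorm[OF s False]] False by (simp add: berk_map_def)
    next
      case True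
      obtain a b where "a * p + b * q = 1" using coprime_poly_bezout[OF assms(2)] by blast
      then have "1 \<le> s a * s p + s b * s q"
        using sn_add[OF s, of "a * p" "b * q"] by (simp add: sn_1[OF s] sn_mult[OF s])
      then have "0 < s p" using True sn_nonneg[OF s, of p] by (cases "s p = 0") auto
      have "eventually (\<lambda>t. M * t q < t p) ?G" for M
      proof -
        have "((\<lambda>t. t p - M * t q) \<longlongrightarrow> s p - M * s q) ?G" by (intro tendsto_intros)
        then have "eventually (\<lambda>t. 0 < t p - M * t q) ?G"
          using True \<open>0 < s p\<close> by (intro order_tendstoD) auto
        then show ?thesis by simp
      qed
      then show ?thesis using limitin_berk_map_None[OF ev] True by (simp add: berk_map_def)
    qed
    then show ?thesis
      unfolding limitin_def Some by (auto intro!: eventually_atin_Some[OF s])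
  next
    case None
    note ev = eventually_at_infty_seminorm
    have "limitin (berk_line v) (\<lambda>t. berk_map v p q (Some t)) (berk_map v p q None) at_infty"
    proof (cases "Polynomial.degree q < Polynomial.degree p")
      case True
      let ?n = "Polynomial.degree p"
      have "eventually (\<lambda>t. M * t q < t p) at_infty" for M
      proof -
        have "((\<lambda>t. t p / t [:0, 1:] ^ ?n - M * (t q / t [:0, 1:] ^ ?n)) \<longlongrightarrow>
               v (poly.coeff p ?n) - M * v (poly.coeff q ?n)) at_infty"
          using True by (intro tendsto_intros tendsto_at_infty) auto
        moreover have "0 < v (poly.coeff p ?n) - M * v (poly.coeff q ?n)"
        proof -
          have "poly.coeff p ?n \<noteq> 0" using True by auto
          then show ?thesis using True v_nonneg v_eq_0_iff by (simp add: coeff_eq_0 less_le)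
        qed
        ultimately have "eventually (\<lambda>t. 0 < t p / t [:0, 1:] ^ ?n - M * (t q / t [:0, 1:] ^ ?n)) at_infty"
          by (rule order_tendstoD)
        with filterlim_at_infty[unfolded filterlim_at_top, rule_format, of 1] show ?thesis
        proof eventually_elim
          case (elim t)
          then have "0 < t [:0, 1:] ^ ?n" by (intro zero_less_power) simp
          moreover have "0 < (t p - M * t q) / t [:0, 1:] ^ ?n" using elim by (simp add: diff_divide_distrib)
          ultimately have "0 < t p - M * t q" by (metis zero_less_divide_iff order_less_asym)
          then show ?case by simp
        qed
      qed
      then show ?thesis
        using limitin_berk_map_None[OF ev] True by (simp add: berk_map_def rat_map_def type_I_def)
    next
      case False
      let ?m = "Polynomial.degree q"
      let ?c = "poly.coeff p ?m / poly.coeff q ?m"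
      have lc: "v (poly.coeff q ?m) \<noteq> 0" using assms by (simp add: v_eq_0_iff)
      have q: "((\<lambda>t. t q / t [:0, 1:] ^ ?m) \<longlongrightarrow> v (poly.coeff q ?m)) at_infty"
        by (intro tendsto_at_infty) simp
      have "eventually (\<lambda>t. t q \<noteq> 0) at_infty"
        using tendsto_imp_eventually_ne[OF q lc] by eventually_elim auto
      moreover have "((\<lambda>t. berk_push p q t f) \<longlongrightarrow> v (poly f ?c)) at_infty" for f
      proof -
        let ?N = "Polynomial.degree f"
        have d: "Polynomial.degree p \<le> ?m" using False by simp
        have "((\<lambda>t. t (clear_denom p q ?N f) / t [:0, 1:] ^ (?m * ?N) / (t q / t [:0, 1:] ^ ?m) ^ ?N) \<longlongrightarrow>
               v (poly.coeff (clear_denom p q ?N f) (?m * ?N)) / v (poly.coeff q ?m) ^ ?N) at_infty"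
          using lc by (intro tendsto_intros tendsto_at_infty q clear_denom_top d assms) auto
        also have "v (poly.coeff (clear_denom p q ?N f) (?m * ?N)) / v (poly.coeff q ?m) ^ ?N = v (poly f ?c)"
          using lc by (simp add: clear_denom_top(1)[OF d assms(1)] v_mult v_power)
        finally show ?thesis
        proof (rule Lim_transform_eventually)
          show "eventually (\<lambda>t. t (clear_denom p q ?N f) / t [:0, 1:] ^ (?m * ?N) /
             (t q / t [:0, 1:] ^ ?m) ^ ?N = berk_push p q t f) at_infty"
            using filterlim_at_infty[unfolded filterlim_at_top, rule_format, of 1]
            by eventually_elim (auto simp: berk_push_def power_divide power_mult)
        qed
      qed
      ultimately show ?thesis
        using limitin_berk_map_Some[OF ev _ berk_seminorm_eval] False
        by (simp add: berk_map_def rat_map_def type_I_def)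
    qed
    then show ?thesis
      unfolding limitin_def None by (auto intro!: eventually_atin_None)
  qed
qed

end

end

theory Submission
  imports Defs
begin

text \<open>
  A \<open>K\<close>-rational point \<open>x\<close> of \<open>V\<close> has a preimage \<open>\<alpha>\<close> under $\phi$ of degree at most
  \<open>d\<close> over \<open>K\<close>: a root of $p - xq$ (of $q$ if $x = \infty$), or $\infty$ if that polynomial
  is constant. As $\phi$ maps both \<open>U\<close> and \<open>V\<close> into \<open>U\<close>, which
  is disjoint from \<open>V\<close>, the point \<open>\<alpha>\<close> lies in neither.
\<close>

lemma ring_of_type_algebra_simps [simp]:
  "carrier ring_of_type_algebra = UNIV"
  "x \<otimes>\<^bsub>ring_of_type_algebra\<^esub> y = x * y"
  "x \<oplus>\<^bsub>ring_of_type_algebra\<^esub> y = x + y"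
  "\<one>\<^bsub>ring_of_type_algebra\<^esub> = 1"
  "\<zero>\<^bsub>ring_of_type_algebra\<^esub> = 0"
  by (simp_all add: ring_of_type_algebra_def)

lemma nat_pow_ring_of_type_algebra [simp]:
  "x [^]\<^bsub>ring_of_type_algebra\<^esub> (n::nat) = (x::'a::field) ^ n"
  by (induction n) (simp_all add: mult.commute)

interpretation type_field: domain "ring_of_type_algebra :: 'a::field ring"
  using field_from_type_algebra by (rule field.axioms)

lemma a_inv_ring_of_type_algebra [simp]:
  "\<ominus>\<^bsub>ring_of_type_algebra\<^esub> x = - (x::'a::field)"
  by (rule type_field.minus_equality) auto

text \<open>The bridge between two encodings: HOL-Algebra lists the coefficients of a polynomial
  from the leading one down, \<open>coeffs\<close> from the constant one up.\<close>

lemma eval_rev_coeffs: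
  "type_field.eval (rev (coeffs f)) x = poly f (x::'a::field)"
proof -
  \<comment> \<open>Generalised to arbitrary lists, because dropping the leading coefficient may
    leave a list that starts with zeros and is no \<open>rev (coeffs g)\<close>.\<close>
  have "type_field.eval cs x = poly (Poly (rev cs)) x" for cs
    by (induction cs) (auto simp: Poly_append poly_monom algebra_simps)
  then show ?thesis by (metis Poly_coeffs rev_rev_ident)
qed

lemma rev_coeffs_in_univ_poly:
  fixes f :: "'a::field poly"
  assumes "\<forall>i. poly.coeff f i \<in> K" and "f \<noteq> 0"
  shows "rev (coeffs f) \<in> carrier (K[X]\<^bsub>ring_of_type_algebra\<^esub>)"
proof -
  have "set (coeffs f) \<subseteq> K"
    using assms(1) by (auto simp: coeffs_def)
  then show ?thesis
    using assms(2)
    by (auto simp: univ_poly_def polynomial_def hd_rev last_coeffs_eq_coeff_degree)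
qed

text \<open>Polynomials over \<open>K\<close> split in the closure, so the multiset of roots has as
  many elements as the degree, which is positive.\<close>

lemma exists_root_in_algebraic_closure:
  fixes f :: "'a::field poly"
  assumes "algebraic_closure (ring_of_type_algebra\<lparr>carrier := L\<rparr>) K"
    and "subfield L ring_of_type_algebra"
    and "\<forall>i. poly.coeff f i \<in> K" and "0 < Polynomial.degree f"
  shows "\<exists>a\<in>L. poly f a = 0"
proof -
  interpret L: algebraic_closure "ring_of_type_algebra\<lparr>carrier := L\<rparr>" K by fact
  let ?P = "rev (coeffs f)"
  have L: "subring L ring_of_type_algebra"
    using assms(2) by (rule subfieldE)
  have "f \<noteq> 0" using assms(4) by auto
  \<comment> \<open>Being a polynomial over \<open>K\<close> depends only on the coefficients and on
    zero, so restricting the ambient carrier to \<open>L\<close> changes nothing.\<close>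
  then have P: "?P \<in> carrier (K[X]\<^bsub>ring_of_type_algebra\<lparr>carrier := L\<rparr>\<^esub>)"
    using rev_coeffs_in_univ_poly[OF assms(3)] by (simp add: univ_poly_def polynomial_def)
  have "K \<subseteq> L" using L.subset by simp
  then have P': "?P \<in> carrier (poly_ring (ring_of_type_algebra\<lparr>carrier := L\<rparr>))"
    using P by (auto simp: univ_poly_def polynomial_def)
  have "size (L.roots ?P) = Polynomial.degree f"
    using L.roots_over_subfield[OF P] by (simp add: L.splitted_def degree_eq_length_coeffs)
  then obtain a where "a \<in># L.roots ?P"
    using assms(4) by (metis less_numeral_extra(3) multiset_nonemptyE size_empty)
  then have "a \<in> L" "L.eval ?P a = 0"
    using L.roots_mem_iff_is_root[OF P'] by (auto simp: L.is_root_def)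
  then show ?thesis
    by (metis type_field.eval_consistent[OF L] eval_rev_coeffs)
qed

lemma ext_degree_le:
  assumes "subfield K ring_of_type_algebra" and "ring.dimension ring_of_type_algebra n K L"
    and "n \<le> d"
  shows "ext_degree K L \<le> enat d"
  using type_field.finite_dimensionI[OF assms(2)] type_field.dimI[OF assms(1,2)] assms(3)
  by (simp add: ext_degree_def over_def)

lemma ext_degree_adjoin_infinity:
  assumes "subfield K ring_of_type_algebra" and "1 \<le> d"
  shows "ext_degree K (adjoin K None) \<le> enat d"
  using ext_degree_le[OF assms(1) type_field.dimension_one[OF assms(1)] assms(2)]
  by (simp add: adjoin_def)

text \<open>For algebraic \<open>a\<close> the ring \<open>K[a]\<close> is already a field, and
  every subfield that contains \<open>K\<close> and \<open>a\<close> contains it. This makes the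
  dimension formula for simple extensions available for \<open>adjoin\<close>.\<close>

lemma adjoin_algebraic:
  assumes K: "subfield K ring_of_type_algebra" and "(type_field.algebraic over K) a"
  shows "adjoin K (Some a) = type_field.simple_extension K a"
proof -
  let ?R = "ring_of_type_algebra :: 'a ring" and ?E = "type_field.simple_extension K a"
  have "subfield ?E ?R"
    using type_field.simple_extension_is_subfield[OF K] assms(2) by simp
  moreover have "insert a K \<subseteq> ?E"
    using type_field.simple_extension_mem[OF subfieldE(1)[OF K], of a]
      type_field.simple_extension_incl[of K a] by simp
  ultimately have "?E = generate_field ?R (insert a K)"
  proof (intro field.generate_fieldI[OF field_from_type_algebra])
    fix F assume "subfield F ?R" "insert a K \<subseteq> F"
    then show "?E \<subseteq> F"
      by (intro type_field.simple_extension_subring_incl) (auto dest: subfieldE(1))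
  qed auto
  then show ?thesis by (simp add: adjoin_def)
qed

text \<open>The dimension of \<open>K(a)\<close> over \<open>K\<close> is the degree of the minimal
  polynomial of \<open>a\<close>, which divides \<open>f\<close>.\<close>

lemma ext_degree_adjoin_root:
  fixes f :: "'a::field poly"
  assumes K: "subfield K ring_of_type_algebra" and coeffs: "\<forall>i. poly.coeff f i \<in> K"
    and "f \<noteq> 0" and "poly f a = 0" and deg: "Polynomial.degree f \<le> d"
  shows "ext_degree K (adjoin K (Some a)) \<le> enat d"
proof -
  let ?P = "rev (coeffs f)"
  have P: "?P \<in> carrier (K[X]\<^bsub>ring_of_type_algebra\<^esub>)" "?P \<noteq> []"
    using rev_coeffs_in_univ_poly[OF coeffs] \<open>f \<noteq> 0\<close> by auto
  have ev: "type_field.eval ?P a = \<zero>\<^bsub>ring_of_type_algebra\<^esub>"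
    using \<open>poly f a = 0\<close> by (simp add: eval_rev_coeffs)
  have alg: "(type_field.algebraic over K) a"
    by (rule type_field.algebraicI[OF P ev])
  have a: "a \<in> carrier ring_of_type_algebra" by simp
  \<comment> \<open>For a nonempty coefficient list, the length minus one is the degree.\<close>
  have "length (type_field.Irr K a) - 1 \<le> length ?P - 1"
    using type_field.pdivides_imp_degree_le[OF subfieldE(1)[OF K] type_field.IrrE(1)[OF K a alg] P
        type_field.Irr_minimal[OF K a alg P(1) ev]] .
  also have "\<dots> \<le> d" using deg by (simp add: degree_eq_length_coeffs)
  finally show ?thesis
    using ext_degree_le[OF K type_field.dimension_simple_extension[OF K a alg]]
    by (simp add: adjoin_algebraic[OF K alg])
qed

lemma coprime_poly_no_common_root:
  fixes p q :: "'a::field poly"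
  assumes "coprime p q"
  shows "poly p a \<noteq> 0 \<or> poly q a \<noteq> 0"
proof -
  obtain r s where "r * p + s * q = 1" using coprime_poly_bezout[OF assms] by blast
  then have "poly r a * poly p a + poly s a * poly q a = 1"
    by (metis poly_1 poly_add poly_mult)
  then show ?thesis by auto
qed

context nonarch_setting
begin

lemma rational_preimage_bounded_degree:
  assumes rat: "rational_function K p q d" and d: "1 \<le> d" and x: "x \<in> proj_line K"
  shows "\<exists>\<alpha>\<in>proj_line Kbar. rat_map p q \<alpha> = x \<and> ext_degree K (adjoin K \<alpha>) \<le> enat d"
proof -
  have p: "\<forall>i. poly.coeff p i \<in> K" and q: "\<forall>i. poly.coeff q i \<in> K"
    and q0: "q \<noteq> 0" and cop: "coprime p q"
    and deg: "d = max (Polynomial.degree p) (Polynomial.degree q)"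
    using rat by (auto simp: rational_function_def)
  \<comment> \<open>Shared by both kinds of target: \<open>f\<close> will be \<open>q\<close> for
    the target infinity and \<open>p - b q\<close> for a finite target \<open>b\<close>.\<close>
  have root: "\<exists>\<alpha>\<in>proj_line Kbar. rat_map p q \<alpha> = x \<and> ext_degree K (adjoin K \<alpha>) \<le> enat d"
    if f: "\<forall>i. poly.coeff f i \<in> K" "0 < Polynomial.degree f" "Polynomial.degree f \<le> d"
      and x: "\<And>a. poly f a = 0 \<Longrightarrow> rat_map p q (Some a) = x" for f
  proof -
    obtain a where a: "a \<in> Kbar" "poly f a = 0"
      using exists_root_in_algebraic_closure[OF Kbar_algebraic_closure Kbar_subfield f(1,2)]
      by blast
    have "ext_degree K (adjoin K (Some a)) \<le> enat d"
      using f a(2) by (intro ext_degree_adjoin_root[OF K_subfield]) auto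
    then show ?thesis using a x by (auto simp: proj_line_def)
  qed
  have infinity: ?thesis if "rat_map p q None = x"
    using that ext_degree_adjoin_infinity[OF K_subfield d] by (auto simp: proj_line_def)
  show ?thesis
  proof (cases x)
    case None
    show ?thesis
    proof (cases "Polynomial.degree q = 0")
      case True
      \<comment> \<open>With \<open>q\<close> constant, \<open>p\<close> has degree
        \<open>d\<close>, which is positive, so infinity is a pole.\<close>
      then show ?thesis using d deg None by (intro infinity) (simp add: rat_map_def)
    next
      case False
      then show ?thesis using q deg None by (intro root[of q]) (auto simp: rat_map_def)
    qed
  next
    case (Some b)
    then have b: "b \<in> K" using x by (auto simp: proj_line_def)
    let ?f = "p - Polynomial.smult b q"
    have degf: "Polynomial.degree ?f \<le> d"
      using deg by (intro degree_diff_le) (auto intro: order.trans[OF degree_smult_le])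
    show ?thesis
    proof (cases "Polynomial.degree ?f = 0")
      case False
      have K: "subring K ring_of_type_algebra" by (rule subfieldE(1)[OF K_subfield])
      have "poly.coeff ?f i \<in> K" for i
      proof -
        have "b * poly.coeff q i \<in> K"
          using subringE(6)[OF K b, of "poly.coeff q i"] q by simp
        from subringE(7)[OF K p[rule_format] subringE(5)[OF K this]] show ?thesis by simp
      qed
      \<comment> \<open>At a zero of \<open>p - b q\<close> that is also a zero of \<open>q\<close>,
        \<open>p\<close> would vanish too, contrary to coprimality; so \<open>a\<close> is no pole
        and its image is \<open>b\<close>.\<close>
      moreover have "rat_map p q (Some a) = x" if "poly ?f a = 0" for a
        using that coprime_poly_no_common_root[OF cop, of a] by (auto simp: rat_map_def Some)
      ultimately show ?thesis using False degf by (intro root[of ?f]) auto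
    next
      case True
      \<comment> \<open>Here \<open>p - b q\<close> is constant, and \<open>d\<close> is positive,
        so the coefficients at \<open>d\<close> cancel.\<close>
      then have "poly.coeff ?f d = 0" using d by (intro coeff_eq_0) simp
      then have top: "poly.coeff p d = b * poly.coeff q d" by simp
      have "Polynomial.degree q = d"
      proof (rule ccontr)
        \<comment> \<open>Otherwise \<open>p\<close> alone attains the degree \<open>d\<close>, yet
          its coefficient there is \<open>b\<close> times the zero coefficient of
          \<open>q\<close>.\<close>
        assume "Polynomial.degree q \<noteq> d"
        then have "Polynomial.degree q < d" "Polynomial.degree p = d" using deg by auto
        moreover from this have "poly.coeff p d = 0" using top by (simp add: coeff_eq_0)
        ultimately show False using d by auto
      qed
      \<comment> \<open>As \<open>p\<close> has degree at most that of \<open>q\<close>, the value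
        at infinity is the quotient of the coefficients at \<open>d\<close>, namely
        \<open>b\<close>.\<close>
      then show ?thesis
        using top deg q0 by (intro infinity) (auto simp: rat_map_def Some)
    qed
  qed
qed

end

theorem theorem3p3:
  fixes v :: "'c::field \<Rightarrow> real" and K Kbar :: "'c set"
    and p q :: "'c poly" and d :: nat
    and \<xi> :: "'c berk_point" and U V :: "'c berk_point set"
  assumes "nonarch_setting v K Kbar"
    and "rational_function K p q d" and "d \<ge> 2"
    and "type_II v \<xi>" and "totally_invariant v p q \<xi>"
    and "U \<in> berk_components v \<xi>" and "V \<in> berk_components v \<xi>" and "U \<noteq> V"
    and "U \<inter> type_I v ` proj_line K \<noteq> {}" and "V \<inter> type_I v ` proj_line K \<noteq> {}"
    and "berk_map v p q ` U \<subseteq> U" and "berk_map v p q ` V \<subseteq> U"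
  shows "\<exists>\<alpha>\<in>proj_line Kbar. type_I v \<alpha> \<notin> U \<union> V \<and> ext_degree K (adjoin K \<alpha>) \<le> enat d"
proof -
  interpret nonarch_setting v K Kbar by fact
  obtain x where x: "x \<in> proj_line K" "type_I v x \<in> V" using assms(10) by auto
  then obtain \<alpha> where \<alpha>: "\<alpha> \<in> proj_line Kbar" "rat_map p q \<alpha> = x"
      "ext_degree K (adjoin K \<alpha>) \<le> enat d"
    using rational_preimage_bounded_degree[OF assms(2), of x] assms(3) by auto
  have "disjnt U V"
    using pairwiseD[OF pairwise_disjoint_connected_components_of] assms(6-8)
    by (simp add: berk_components_def)
  \<comment> \<open>On type I points \<open>berk_map\<close> acts as \<open>rat_map\<close>, so this
    image is the chosen point of \<open>V\<close>.\<close>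
  then have "berk_map v p q (type_I v \<alpha>) \<notin> U"
    using x(2) by (auto simp: berk_map_type_I \<alpha>(2) disjnt_iff)
  then have "type_I v \<alpha> \<notin> U \<union> V" using assms(11,12) by blast
  with \<alpha> show ?thesis by blast
qed

end
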